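(* Let $M=(E,r)$ be a rank-$r$ paving matroid with $n=|E|$ elements. (1) If $2r>n$, then $E$ is the union of two bases of $M$. (2) If $2r\le n$ and $M$ is coloopless, then $M$ contains two disjoint bases.
   Context: Matroids are finite; by abuse of notation $r$ denotes both the rank function and the rank $r(E)$ of $M$. A paving matroid is a matroid all of whose circuits have size at least its rank $r$. A matroid is coloopless if no element belongs to every basis. *)

theory Defs
  imports Main
begin

text \<open>
  A finite matroid \<open>M = (E, r)\<close>, presented by its rank function. Only the values of \<open>r\<close> on
  subsets of the ground set are constrained; all the notions below only refer to such subsets.
\<close>

locale matroid =
  fixes E :: "'a set" and r :: "'a set \<Rightarrow> nat"
  assumes finite_ground: "finite E"
    and rank_le_card: "X \<subseteq> E \<Longrightarrow> r X \<le> card X"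
    and rank_mono: "X \<subseteq> Y \<Longrightarrow> Y \<subseteq> E \<Longrightarrow> r X \<le> r Y"
    and rank_submodular:
      "X \<subseteq> E \<Longrightarrow> Y \<subseteq> E \<Longrightarrow> r (X \<union> Y) + r (X \<inter> Y) \<le> r X + r Y"

definition indep :: "'a set \<Rightarrow> ('a set \<Rightarrow> nat) \<Rightarrow> 'a set \<Rightarrow> bool" where
  "indep E r X \<longleftrightarrow> X \<subseteq> E \<and> r X = card X"

definition basis :: "'a set \<Rightarrow> ('a set \<Rightarrow> nat) \<Rightarrow> 'a set \<Rightarrow> bool" where
  "basis E r B \<longleftrightarrow> indep E r B \<and> (\<forall>X. indep E r X \<and> B \<subseteq> X \<longrightarrow> X = B)"

definition circuit :: "'a set \<Rightarrow> ('a set \<Rightarrow> nat) \<Rightarrow> 'a set \<Rightarrow> bool" where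
  "circuit E r C \<longleftrightarrow> C \<subseteq> E \<and> \<not> indep E r C \<and> (\<forall>X. X \<subset> C \<longrightarrow> indep E r X)"

definition paving :: "'a set \<Rightarrow> ('a set \<Rightarrow> nat) \<Rightarrow> bool" where
  "paving E r \<longleftrightarrow> (\<forall>C. circuit E r C \<longrightarrow> r E \<le> card C)"

definition coloopless :: "'a set \<Rightarrow> ('a set \<Rightarrow> nat) \<Rightarrow> bool" where
  "coloopless E r \<longleftrightarrow> \<not> (\<exists>e\<in>E. \<forall>B. basis E r B \<longrightarrow> e \<in> B)"

end

theory Submission
  imports Defs
begin

text \<open>
  In a paving matroid every set of fewer than \<open>r\<close> elements is independent. If \<open>2r > n\<close>, this
  applies to the complement of any basis, which therefore extends to a second basis.
  If \<open>2r \<le> n\<close>, let \<open>A\<close> be the complement of a basis \<open>B\<close>; we may assume that \<open>A\<close>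
  does not span, for otherwise it contains a basis. Choose
  \<open>d \<in> B\<close> with \<open>A + d\<close> of larger rank than \<open>A\<close>, and, as \<open>d\<close> is not a coloop,
  \<open>x \<in> A\<close> with \<open>B - d + x\<close> a basis. Since \<open>A - x\<close> still has at least \<open>r - 1\<close> elements, it
  contains an independent set of size \<open>r - 1\<close>, which spans \<open>A\<close>; adding \<open>d\<close> to it gives a basis
  disjoint from \<open>B - d + x\<close>.
\<close>

context matroid
begin

section \<open>Rank function, independence and bases\<close>

lemma finite_subset_ground: "X \<subseteq> E \<Longrightarrow> finite X"
  using finite_ground by (rule rev_finite_subset)

lemma rank_Un_le:
  assumes "X \<subseteq> E" "Y \<subseteq> E"
  shows "r (X \<union> Y) \<le> r X + card Y"
  using rank_submodular[OF assms] rank_le_card[OF assms(2)] by linarith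

lemma rank_insert_le:
  assumes "X \<subseteq> E" "x \<in> E"
  shows "r (insert x X) \<le> Suc (r X)"
  using rank_Un_le[of X "{x}"] assms by simp

text \<open>Deleting \<open>Y - X\<close> lowers the rank by at most its size, so no rank deficit
  can appear in \<open>X\<close>.\<close>

lemma indep_subset:
  assumes "indep E r Y" "X \<subseteq> Y"
  shows "indep E r X"
proof -
  have Y: "Y \<subseteq> E" "r Y = card Y"
    using assms(1) by (auto simp: indep_def)
  have "card Y = card X + card (Y - X)"
    using assms(2) finite_subset_ground[OF Y(1)]
    by (metis card_Diff_subset card_mono finite_subset le_add_diff_inverse)
  moreover have "r Y \<le> r X + card (Y - X)"
    using rank_Un_le[of X "Y - X"] assms(2) Y(1) by (auto simp: Un_absorb1)
  moreover have "r X \<le> card X"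
    using rank_le_card assms(2) Y(1) by blast
  ultimately show ?thesis
    using assms(2) Y by (auto simp: indep_def)
qed

text \<open>By submodularity, if no single element of \<open>Y - X\<close> raises the rank of
  \<open>X\<close>, then adding them one at a time never does, so \<open>Y\<close> would have the
  rank of \<open>X\<close>.\<close>

lemma rank_augment:
  assumes "X \<subseteq> Y" "Y \<subseteq> E" "r X < r Y"
  obtains y where "y \<in> Y - X" "r X < r (insert y X)"
proof (rule ccontr)
  assume "\<not> thesis"
  with that have no_gain: "r (insert y X) \<le> r X" if "y \<in> Y - X" for y
    using \<open>y \<in> Y - X\<close> by fastforce
  have finYX: "finite (Y - X)"
    using finite_subset_ground[OF assms(2)] by simp
  have "r (X \<union> Z) \<le> r X" if "Z \<subseteq> Y - X" for Z
    using rev_finite_subset[OF finYX that] that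
  proof (induction Z rule: finite_induct)
    case empty
    show ?case by simp
  next
    case (insert z Z)
    have eq: "(X \<union> Z) \<union> insert z X = X \<union> insert z Z" by blast
    \<comment> \<open>The intersection contains \<open>X\<close>, so \<open>z\<close> raises the
      rank of \<open>X \<union> Z\<close> by no more than it raises that of
      \<open>X\<close>.\<close>
    have "r (X \<union> insert z Z) + r ((X \<union> Z) \<inter> insert z X) \<le> r (X \<union> Z) + r (insert z X)"
      using rank_submodular[of "X \<union> Z" "insert z X"] insert.prems assms(1,2)
      unfolding eq by auto
    moreover have "r X \<le> r ((X \<union> Z) \<inter> insert z X)"
      using assms(1,2) insert.prems by (intro rank_mono) auto
    ultimately show ?case
      using insert.IH insert.prems no_gain[of z] by auto
  qed
  from this[of "Y - X"] have "r Y \<le> r X"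
    using assms(1) by (simp add: Un_absorb1)
  with assms(3) show False by simp
qed

text \<open>A maximal independent set spans, since \<open>rank_augment\<close> would otherwise
  enlarge it. This turns maximality into numerical conditions and makes all bases
  equicardinal.\<close>

lemma basis_iff: "basis E r B \<longleftrightarrow> B \<subseteq> E \<and> r B = r E \<and> card B = r E"
proof
  assume "basis E r B"
  then have B: "B \<subseteq> E" "r B = card B"
    and maximal: "\<And>X. indep E r X \<Longrightarrow> B \<subseteq> X \<Longrightarrow> X = B"
    by (auto simp: basis_def indep_def)
  have "r B = r E"
  proof (rule ccontr)
    assume "r B \<noteq> r E"
    with rank_mono[OF B(1)] have "r B < r E" by fastforce
    then obtain y where y: "y \<in> E - B" "r B < r (insert y B)"
      using rank_augment[OF B(1)] by blast
    have "r (insert y B) \<le> card (insert y B)"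
      using y(1) B(1) by (intro rank_le_card) auto
    with y B have "indep E r (insert y B)"
      using finite_subset_ground[OF B(1)] by (auto simp: indep_def)
    with maximal y(1) show False by blast
  qed
  with B show "B \<subseteq> E \<and> r B = r E \<and> card B = r E" by simp
next
  assume B: "B \<subseteq> E \<and> r B = r E \<and> card B = r E"
  show "basis E r B"
    unfolding basis_def
  proof (intro conjI allI impI)
    show "indep E r B" using B by (simp add: indep_def)
  next
    fix X assume X: "indep E r X \<and> B \<subseteq> X"
    then have "X \<subseteq> E" "card X \<le> card B"
      using B rank_mono[of X E] by (auto simp: indep_def)
    with X show "X = B"
      using card_seteq[of X B] finite_subset_ground by auto
  qed
qed

lemma basis_indep: "basis E r B \<Longrightarrow> indep E r B"
  by (simp add: basis_def)

lemma basisI: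
  assumes "B \<subseteq> E" "card B \<le> r E" "r E \<le> r B"
  shows "basis E r B"
  using assms rank_le_card[of B] rank_mono[of B E] by (auto simp: basis_iff)

text \<open>A maximal independent set between \<open>X\<close> and \<open>Y\<close> spans
  \<open>Y\<close>. Allowing any spanning \<open>Y\<close> in place of \<open>E\<close> serves to
  find a basis inside the complement of another.\<close>

lemma indep_extend:
  assumes "indep E r X" "X \<subseteq> Y" "Y \<subseteq> E" "r Y = r E"
  obtains B where "basis E r B" "X \<subseteq> B" "B \<subseteq> Y"
proof -
  let ?S = "{Z. indep E r Z \<and> X \<subseteq> Z \<and> Z \<subseteq> Y}"
  have "finite ?S"
    using finite_subset_ground[OF assms(3)] by (auto intro: rev_finite_subset[of "Pow Y"])
  moreover have "X \<in> ?S" using assms(1,2) by simp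
  ultimately have "\<exists>B\<in>?S. X \<subseteq> B \<and> (\<forall>Z\<in>?S. B \<subseteq> Z \<longrightarrow> B = Z)"
    by (rule finite_has_maximal2)
  then obtain B where B: "B \<in> ?S" and maximal: "\<And>Z. Z \<in> ?S \<Longrightarrow> B \<subseteq> Z \<Longrightarrow> B = Z"
    by (elim bexE conjE) (simp only: Ball_def)
  from B have BE: "B \<subseteq> E" "r B = card B" "B \<subseteq> Y"
    by (auto simp: indep_def)
  have "r Y \<le> r B"
  proof (rule ccontr)
    assume "\<not> r Y \<le> r B"
    then have "r B < r Y" by simp
    then obtain y where y: "y \<in> Y - B" "r B < r (insert y B)"
      by (rule rank_augment[OF BE(3) assms(3)])
    have "r (insert y B) \<le> card (insert y B)"
      using y(1) BE assms(3) by (intro rank_le_card) auto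
    with y BE have "indep E r (insert y B)"
      using finite_subset_ground[OF BE(1)] assms(3) by (auto simp: indep_def)
    with maximal[of "insert y B"] B y(1) show False by blast
  qed
  with BE assms(4) rank_mono[of B E] have "basis E r B"
    by (intro basisI) auto
  with B that show thesis by blast
qed

lemma indep_empty: "indep E r {}"
  using rank_le_card[of "{}"] by (simp add: indep_def)

lemma basis_exists:
  obtains B where "basis E r B"
  using indep_extend[OF indep_empty, of E] by blast

section \<open>Circuits, the paving condition and exchange at non-coloops\<close>

lemma dependent_contains_circuit:
  assumes "X \<subseteq> E" "\<not> indep E r X"
  obtains C where "circuit E r C" "C \<subseteq> X"
proof -
  let ?S = "{Z. Z \<subseteq> X \<and> \<not> indep E r Z}"
  have "finite ?S"
    using finite_subset_ground[OF assms(1)] by (auto intro: rev_finite_subset[of "Pow X"])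
  moreover have "X \<in> ?S" using assms(2) by simp
  ultimately have "\<exists>C\<in>?S. C \<subseteq> X \<and> (\<forall>Z\<in>?S. Z \<subseteq> C \<longrightarrow> C = Z)"
    by (rule finite_has_minimal2)
  then obtain C where C: "C \<in> ?S" and minimal: "\<And>Z. Z \<in> ?S \<Longrightarrow> Z \<subseteq> C \<Longrightarrow> C = Z"
    by (elim bexE conjE) (simp only: Ball_def)
  have "circuit E r C"
    unfolding circuit_def
  proof (intro conjI allI impI)
    show "C \<subseteq> E" "\<not> indep E r C" using C assms(1) by auto
    show "indep E r Z" if "Z \<subset> C" for Z
      using minimal[of Z] C that by auto
  qed
  with C that show thesis by blast
qed

lemma paving_indep:
  assumes "paving E r" "X \<subseteq> E" "card X < r E"
  shows "indep E r X"
proof (rule ccontr)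
  assume "\<not> indep E r X"
  then obtain C where "circuit E r C" "C \<subseteq> X"
    using dependent_contains_circuit assms(2) by blast
  then have "r E \<le> card X"
    using assms(1) card_mono[OF finite_subset_ground[OF assms(2)]]
    unfolding paving_def by (meson order_trans)
  with assms(3) show False by simp
qed

text \<open>A basis avoiding \<open>d\<close> shows that \<open>E - {d}\<close> has full rank, while
  \<open>B - {d}\<close> falls one short; augmenting inside \<open>E - {d}\<close> keeps the new
  element different from \<open>d\<close>.\<close>

lemma basis_exchange_noncoloop:
  assumes "coloopless E r" "basis E r B" "d \<in> B"
  obtains x where "x \<in> E - B" "basis E r (insert x (B - {d}))"
proof -
  have B: "B \<subseteq> E" "card B = r E"
    using assms(2) by (auto simp: basis_iff)
  have finB: "finite B"
    using finite_subset_ground[OF B(1)] .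
  obtain B' where B': "basis E r B'" "d \<notin> B'"
    using assms B(1) unfolding coloopless_def by blast
  then have "r E \<le> r (E - {d})"
    using rank_mono[of B' "E - {d}"] by (auto simp: basis_iff)
  moreover have rank_hyp: "Suc (r (B - {d})) = r E"
    using indep_subset[OF basis_indep[OF assms(2)], of "B - {d}"]
      card_Suc_Diff1[OF finB assms(3)] B(2)
    by (simp add: indep_def Diff_subset)
  ultimately obtain x where x: "x \<in> (E - {d}) - (B - {d})"
      "r (B - {d}) < r (insert x (B - {d}))"
    using rank_augment[of "B - {d}" "E - {d}"] B(1)
    by (metis Diff_mono Diff_subset lessI order_less_le_trans order_refl)
  have "card (insert x (B - {d})) = card B"
    using card_insert_disjoint[of "B - {d}" x] card_Suc_Diff1[OF finB assms(3)] x(1) finB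
    by (metis DiffD2 finite_Diff)
  then have "basis E r (insert x (B - {d}))"
    using x B rank_hyp by (intro basisI) auto
  with x(1) that show thesis by blast
qed

section \<open>Covering by two bases and finding two disjoint bases\<close>

lemma paving_two_bases_cover:
  assumes "paving E r" "card E < 2 * r E"
  obtains B1 B2 where "basis E r B1" "basis E r B2" "E = B1 \<union> B2"
proof -
  obtain B where B: "basis E r B" by (rule basis_exists)
  then have BE: "B \<subseteq> E" "card B = r E" by (auto simp: basis_iff)
  have "card (E - B) < r E"
    using assms(2) BE card_Diff_subset[OF finite_subset_ground[OF BE(1)] BE(1)] by simp
  then have "indep E r (E - B)"
    using paving_indep[OF assms(1)] by blast
  then obtain B' where "basis E r B'" "E - B \<subseteq> B'"
    by (rule indep_extend[where Y = E]) auto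
  moreover from this have "E = B \<union> B'"
    using BE(1) by (auto simp: basis_iff)
  ultimately show thesis using B that by blast
qed

lemma paving_two_bases_disjoint:
  assumes "paving E r" "2 * r E \<le> card E" "coloopless E r"
  obtains B1 B2 where "basis E r B1" "basis E r B2" "B1 \<inter> B2 = {}"
proof -
  obtain B where B: "basis E r B" by (rule basis_exists)
  then have BE: "B \<subseteq> E" "card B = r E" by (auto simp: basis_iff)
  define A where "A = E - B"
  have A: "A \<subseteq> E" "A \<inter> B = {}" "r E \<le> card A"
    using assms(2) BE card_Diff_subset[OF finite_subset_ground[OF BE(1)] BE(1)]
    by (auto simp: A_def)
  show thesis
  proof (cases "r A = r E")
    case True
    then obtain B' where "basis E r B'" "B' \<subseteq> A"
      using indep_extend[OF indep_empty _ A(1)] by blast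
    with B A(2) that show thesis by blast
  next
    case False
    with rank_mono[OF A(1)] have small: "r A < r E" by fastforce
    then obtain d where d: "d \<in> E - A" "r A < r (insert d A)"
      using rank_augment[OF A(1)] by blast
    then have "d \<in> B" by (simp add: A_def)
    then obtain x where x: "x \<in> E - B" "basis E r (insert x (B - {d}))"
      using basis_exchange_noncoloop[OF assms(3) B] by blast
    have "r E - 1 \<le> card (A - {x})"
      using A(3) x(1) finite_subset_ground[OF A(1)] by (simp add: A_def)
    then obtain S where S: "S \<subseteq> A - {x}" "card S = r E - 1"
      by (meson obtain_subset_with_card_n)
    then have SE: "S \<subseteq> E" "S \<subseteq> A" "d \<notin> S" using A(1) d(1) by auto
    \<comment> \<open>\<open>small\<close> forces \<open>r E > 0\<close>, so the subtraction is not
      truncated and \<open>S\<close> has fewer than \<open>r E\<close> elements.\<close>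
    have rankS: "r S = r E - 1"
      using paving_indep[OF assms(1) SE(1)] S(2) small by (simp add: indep_def)
    \<comment> \<open>Submodularity: \<open>d\<close> raises the rank of \<open>S\<close> at least
      as much as that of the larger set \<open>A\<close>, hence by at least one, which brings
      \<open>insert d S\<close> to rank \<open>r E\<close>.\<close>
    have "r (insert d A) + r S \<le> r (insert d S) + r A"
    proof -
      have "insert d S \<union> A = insert d A" "insert d S \<inter> A = S"
        using SE d(1) by auto
      with rank_submodular[of "insert d S" A] SE(1) A(1) d(1) show ?thesis by simp
    qed
    then have "basis E r (insert d S)"
      using d rankS S(2) SE small finite_subset_ground[OF SE(1)] by (intro basisI) auto
    \<comment> \<open>\<open>S\<close> lies in \<open>A\<close> and avoids \<open>x\<close>, while
      \<open>d\<close> was removed from \<open>B\<close> and differs from \<open>x\<close>, which is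
      outside \<open>B\<close>.\<close>
    moreover have "insert x (B - {d}) \<inter> insert d S = {}"
      using S(1) A(2) \<open>d \<in> B\<close> x(1) by auto
    ultimately show thesis using x(2) that by blast
  qed
qed

end

theorem theorem4p1:
  fixes E :: "'a set" and r :: "'a set \<Rightarrow> nat"
  assumes "matroid E r" and "paving E r"
  shows "(2 * r E > card E \<longrightarrow>
           (\<exists>B1 B2. basis E r B1 \<and> basis E r B2 \<and> E = B1 \<union> B2)) \<and>
         (2 * r E \<le> card E \<and> coloopless E r \<longrightarrow>
           (\<exists>B1 B2. basis E r B1 \<and> basis E r B2 \<and> B1 \<inter> B2 = {}))"
proof -
  interpret matroid E r by (rule assms(1))
  show ?thesis
    by (meson paving_two_bases_cover[OF assms(2)] paving_two_bases_disjoint[OF assms(2)])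
qed

end
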